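(* Let $\varphi\in H^\infty$ be a nonconstant function with $\|\varphi\|_\infty=1$, and let $\mathcal E\subset\mathbb T$ be a Lebesgue measurable set such that $\varphi$ has an angular derivative at almost every point of $\mathcal E$. Assume that $\log|\varphi'|\in L^1(\mathcal E)$ (where $\varphi'(\zeta)$ denotes the angular derivative at $\zeta$), and let $\mathcal O$ be the outer function with modulus $|\varphi'|\chi_{\mathcal E}+\chi_{\mathbb T\setminus\mathcal E}$, so that $|\mathcal O(z)|=\exp\{\int_{\mathcal E}\log|\varphi'|\,d\omega_z\}$. Then for all $z\in\mathbb D$, $$\frac{1-|\varphi(z)|^2}{1-|z|^2}\le|\mathcal O(z)|\left\{\frac{1}{1-\omega_z(\mathcal E)}\cdot\frac{1+|z|}{1-|z|}\right\}^{1-\omega_z(\mathcal E)}.$$ (When $\omega_z(\mathcal E)=1$, the bracketed factor is interpreted as $1$.)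
   Context: $\mathbb D=\{|z|<1\}$, $\mathbb T=\partial\mathbb D$, $m$ is normalized arclength measure on $\mathbb T$, $H^\infty$ is the algebra of bounded holomorphic functions on $\mathbb D$ with sup norm. A function $\varphi\in H^\infty$ with $\|\varphi\|_\infty\le1$ has an angular derivative at $\zeta\in\mathbb T$ if $\varphi$ and $\varphi'$ have nontangential limits $\varphi(\zeta)$, $\varphi'(\zeta)$ at $\zeta$ and $|\varphi(\zeta)|=1$. The harmonic measure at $z\in\mathbb D$ is $d\omega_z(\zeta)=\frac{1-|z|^2}{|\zeta-z|^2}\,dm(\zeta)$, and $\omega_z(E)=\int_E d\omega_z$. For $h\ge0$ on $\mathbb T$ with $\log h\in L^1(\mathbb T)$, the outer function with modulus $h$ is $\mathcal O_h(z)=\exp\{\int_{\mathbb T}\frac{\zeta+z}{\zeta-z}\log h(\zeta)\,dm(\zeta)\}$; $\chi_E$ denotes the characteristic function of $E$. *)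

theory Defs
  imports "HOL-Analysis.Analysis"
begin

text \<open>Unit disc is ball 0 1, unit circle is sphere 0 1, parametrised by t \<mapsto> cis t, t in [0, 2 pi].
  Normalized arclength m corresponds to Lebesgue measure on [0, 2 pi] divided by 2 pi.\<close>

definition stolz :: "real \<Rightarrow> complex \<Rightarrow> complex set" where
  "stolz \<alpha> \<zeta> = {z \<in> ball 0 1. cmod (z - \<zeta>) < \<alpha> * (1 - cmod z)}"

definition nt_limit :: "(complex \<Rightarrow> complex) \<Rightarrow> complex \<Rightarrow> complex \<Rightarrow> bool" where
  "nt_limit f \<zeta> L \<longleftrightarrow> (\<forall>\<alpha>>1. (f \<longlongrightarrow> L) (at \<zeta> within stolz \<alpha> \<zeta>))"

definition has_angular_derivative :: "(complex \<Rightarrow> complex) \<Rightarrow> complex \<Rightarrow> bool" where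
  "has_angular_derivative \<phi> \<zeta> \<longleftrightarrow>
     (\<exists>L. nt_limit \<phi> \<zeta> L \<and> cmod L = 1) \<and> (\<exists>D. nt_limit (deriv \<phi>) \<zeta> D)"

definition angular_derivative :: "(complex \<Rightarrow> complex) \<Rightarrow> complex \<Rightarrow> complex" where
  "angular_derivative \<phi> \<zeta> = (THE D. nt_limit (deriv \<phi>) \<zeta> D)"

definition arcs :: "complex set \<Rightarrow> real set" where
  "arcs E = {t \<in> {0..2*pi}. cis t \<in> E}"

definition harmonic_measure :: "complex \<Rightarrow> complex set \<Rightarrow> real" where
  "harmonic_measure z E =
     (LINT t:arcs E|lebesgue. (1 - (cmod z)\<^sup>2) / (cmod (cis t - z))\<^sup>2) / (2 * pi)"

definition outer_function :: "(complex \<Rightarrow> real) \<Rightarrow> complex \<Rightarrow> complex" where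
  "outer_function h z =
     exp ((LINT t:{0..2*pi}|lebesgue.
             ((cis t + z) / (cis t - z)) * complex_of_real (ln (h (cis t)))) / (2 * pi))"

end

theory Submission
  imports Defs "HOL-Complex_Analysis.Complex_Analysis"
begin

text \<open>
  For fixed \<open>w\<close> the de Branges--Rovnyak kernel
  \<open>k\<^sub>w(u) = (1 - cnj (\<phi> w) \<phi> u) / (1 - cnj w u)\<close> has no zeros in the disc, so
  \<open>log (\<bar>k\<^sub>w\<bar>\<^sup>2 / k\<^sub>w(w))\<close> is harmonic. Its value at \<open>w\<close>, the logarithm of
  \<open>k\<^sub>w(w) = (1 - \<bar>\<phi> w\<bar>\<^sup>2) / (1 - \<bar>w\<bar>\<^sup>2)\<close>, is therefore its Poisson integral over the circle.
  On \<open>E\<close> the Schwarz--Pick inequality \<open>\<bar>k\<^sub>w(u)\<bar>\<^sup>2 \<le> k\<^sub>w(w) k\<^sub>u(u)\<close> and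
  \<open>k\<^sub>u(u) \<rightarrow> \<bar>\<phi>'(\<zeta>)\<bar>\<close> bound the integrand by \<open>log \<bar>\<phi>'\<bar>\<close>; off \<open>E\<close> one uses Jensen's inequality and
  \<open>\<integral> \<bar>k\<^sub>w\<bar>\<^sup>2 / k\<^sub>w(w) d\<omega>\<^sub>w \<le> (1 + \<bar>w\<bar>) / (1 - \<bar>w\<bar>)\<close>. To avoid boundary values of \<open>\<phi>\<close>, the argument is run
  for \<open>u \<mapsto> \<phi> (r u)\<close> with \<open>r \<up> 1\<close>.
\<close>

section \<open>The Poisson kernel\<close>

text \<open>Left unnormalised, like the integrand of \<open>harmonic_measure\<close>: for
  \<open>cmod w < 1\<close> its total mass over \<open>{0..2*pi}\<close> is
  \<open>2 * pi\<close>.\<close>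

definition poisson :: "complex \<Rightarrow> real \<Rightarrow> real" where
  "poisson w t = (1 - (cmod w)\<^sup>2) / (cmod (cis t - w))\<^sup>2"

text \<open>\<open>\<bar>k\<^sub>w(\<zeta>)\<bar>\<^sup>2 / k\<^sub>w(w)\<close> for the kernel of \<open>g\<close>.\<close>

definition kernel_ratio :: "(complex \<Rightarrow> complex) \<Rightarrow> complex \<Rightarrow> complex \<Rightarrow> real" where
  "kernel_ratio g w \<zeta> = ((cmod (1 - cnj (g w) * g \<zeta>))\<^sup>2 / (1 - (cmod (g w))\<^sup>2))
     * ((1 - (cmod w)\<^sup>2) / (cmod (1 - cnj w * \<zeta>))\<^sup>2)"

lemma one_minus_norm_sq_pos: "cmod w < 1 \<Longrightarrow> 0 < 1 - (cmod w)\<^sup>2"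
  by (simp add: power_less_one_iff abs_square_less_1)

lemma norm_one_minus_cnj_mult_ge:
  assumes "cmod u \<le> 1"
  shows "1 - cmod w \<le> cmod (1 - cnj w * u)"
proof -
  have "cmod (cnj w * u) \<le> cmod w"
    using assms by (simp add: norm_mult mult_left_le)
  then show ?thesis
    using norm_triangle_ineq2[of 1 "cnj w * u"] by simp
qed

lemma one_minus_cnj_mult_neq_0:
  assumes "cmod w < 1" "cmod u \<le> 1"
  shows "1 - cnj w * u \<noteq> 0"
  using norm_one_minus_cnj_mult_ge[OF assms(2), of w] assms(1) by auto

lemma cnj_mult_neq_1: "cmod w < 1 \<Longrightarrow> cmod u \<le> 1 \<Longrightarrow> cnj w * u \<noteq> 1"
  using one_minus_cnj_mult_neq_0[of w u] by auto

lemma norm_one_minus_cnj_mult_le: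
  assumes "cmod u \<le> 1"
  shows "cmod (1 - cnj w * u) \<le> 1 + cmod w"
proof -
  have "cmod (cnj w * u) \<le> cmod w"
    using assms by (simp add: norm_mult mult_left_le)
  then show ?thesis
    using norm_triangle_ineq4[of 1 "cnj w * u"] by simp
qed

lemma cnj_cis_mult: "cis t * (cnj (cis t) - w) = 1 - w * cis t"
  by (simp add: right_diff_distrib cis_cnj cis_mult mult.commute)

lemma norm_cis_minus: "cmod (cis t - w) = cmod (1 - cnj w * cis t)"
proof -
  have "cmod (1 - cnj w * cis t) = cmod (cnj (cis t) - cnj w)"
    using arg_cong[OF cnj_cis_mult[of t "cnj w"], of cmod] by (simp add: norm_mult)
  then show ?thesis
    by (metis complex_cnj_diff complex_mod_cnj)
qed

text \<open>In this form the Poisson kernel is visibly the second factor of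
  \<open>kernel_ratio\<close> at \<open>cis t\<close>.\<close>

lemma poisson_alt: "poisson w t = (1 - (cmod w)\<^sup>2) / (cmod (1 - cnj w * cis t))\<^sup>2"
  by (simp add: poisson_def norm_cis_minus)

lemma poisson_pos: "cmod w < 1 \<Longrightarrow> 0 < poisson w t"
  unfolding poisson_alt
  by (intro divide_pos_pos one_minus_norm_sq_pos) (auto simp: cnj_mult_neq_1)

lemma poisson_le:
  assumes "cmod w < 1"
  shows "poisson w t \<le> (1 + cmod w) / (1 - cmod w)"
proof -
  have "poisson w t \<le> (1 - (cmod w)\<^sup>2) / (1 - cmod w)\<^sup>2"
    unfolding poisson_alt using assms one_minus_norm_sq_pos[OF assms]
    by (intro divide_left_mono power_mono norm_one_minus_cnj_mult_ge mult_pos_pos zero_less_power)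
       (auto simp: cnj_mult_neq_1)
  also have "\<dots> = (1 + cmod w) / (1 - cmod w)"
  proof -
    have "1 - (cmod w)\<^sup>2 = (1 + cmod w) * (1 - cmod w)"
      by (simp add: power2_eq_square algebra_simps)
    then show ?thesis
      using assms by (simp add: power2_eq_square)
  qed
  finally show ?thesis .
qed

lemma continuous_on_poisson [continuous_intros]: "cmod w < 1 \<Longrightarrow> continuous_on S (poisson w)"
  unfolding poisson_alt[abs_def]
  by (intro continuous_intros) (auto simp: cnj_mult_neq_1)

lemma poisson_measurable [measurable]: "cmod w < 1 \<Longrightarrow> poisson w \<in> borel_measurable borel"
  by (intro borel_measurable_continuous_onI continuous_on_poisson)

text \<open>Links the kernel in \<open>outer_function\<close> to harmonic measure; the numerator
  becomes real after multiplying by the conjugate of the denominator.\<close>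

lemma Re_herglotz_kernel: "Re ((cis t + w) / (cis t - w)) = poisson w t"
proof -
  have "(cis t + w) / (cis t - w) = (cis t + w) * cnj (cis t - w) / (cmod (cis t - w))\<^sup>2"
    by (metis complex_div_cnj)
  also have "Re \<dots> = Re ((cis t + w) * cnj (cis t - w)) / (cmod (cis t - w))\<^sup>2"
    by (metis Re_divide_of_real)
  also have "Re ((cis t + w) * cnj (cis t - w)) = 1 - (cmod w)\<^sup>2"
    by (simp add: cmod_power2 algebra_simps) (metis sin_cos_squared_add2 power2_eq_square add.commute)
  finally show ?thesis by (simp add: poisson_def)
qed

section \<open>Poisson's formula for functions holomorphic on the closed disc\<close>

lemma poisson_integral:
  fixes f :: "complex \<Rightarrow> complex"
  assumes "f holomorphic_on cball 0 1" "cmod w < 1"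
  shows "((\<lambda>t. f (cis t) * of_real (poisson w t)) has_integral 2 * pi * f w) {0..2*pi}"
proof -
  \<comment> \<open>Cauchy's formula for \<open>F\<close>, since on the circle \<open>\<zeta> / (1 - cnj w \<zeta>) = 1 / cnj (\<zeta> - w)\<close>.\<close>
  define F where "F = (\<lambda>u. f u * of_real (1 - (cmod w)\<^sup>2) / (1 - cnj w * u))"
  have "F holomorphic_on cball 0 1"
    unfolding F_def using assms(1) one_minus_cnj_mult_neq_0[OF assms(2)]
    by (intro holomorphic_intros) auto
  then have "((\<lambda>u. F u / (u - w)) has_contour_integral (2 * of_real pi * \<i> * F w)) (circlepath 0 1)"
    using assms by (intro Cauchy_integral_circlepath_simple) auto
  then have "((\<lambda>t. F (cis t) / (cis t - w) * \<i> * cis t) has_integral (2 * of_real pi * \<i> * F w)) {0..2*pi}"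
    unfolding circlepath_def by (subst (asm) has_contour_integral_part_circlepath_iff) auto
  then have "((\<lambda>t. (- \<i>) * (F (cis t) / (cis t - w) * \<i> * cis t)) has_integral (- \<i>) * (2 * of_real pi * \<i> * F w)) {0..2*pi}"
    by (rule has_integral_mult_right)
  \<comment> \<open>The factor \<open>1 - (cmod w)\<^sup>2\<close> in \<open>F\<close> is chosen to
    cancel the denominator at \<open>u = w\<close>.\<close>
  moreover have "F w = f w"
  proof -
    have "1 - cnj w * w = of_real (1 - (cmod w)\<^sup>2)"
      by (simp add: complex_norm_square[symmetric] mult.commute flip: of_real_power)
    moreover have "1 - cnj w * w \<noteq> 0"
      using one_minus_cnj_mult_neq_0[of w w] assms by auto
    ultimately show ?thesis by (simp add: F_def)
  qed
  \<comment> \<open>The \<open>cis t\<close> from the contour parametrisation cancels the one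
    extracted from \<open>1 - cnj w * cis t\<close>, leaving the squared modulus of
    \<open>cis t - w\<close>.\<close>
  moreover have "(- \<i>) * (F (cis t) / (cis t - w) * \<i> * cis t) = f (cis t) * of_real (poisson w t)" for t
  proof -
    have *: "1 - cnj w * cis t = cis t * cnj (cis t - w)"
      using cnj_cis_mult[of t "cnj w"] by simp
    have "of_real (poisson w t) = of_real (1 - (cmod w)\<^sup>2) / ((cis t - w) * cnj (cis t - w))"
      unfolding poisson_def by (metis complex_norm_square of_real_divide of_real_power)
    moreover have "(- \<i>) * (y * k / (c * u) / x * \<i> * c) = y * (k / (x * u))" if "c \<noteq> 0" for c k u x y :: complex
      using that by (simp add: divide_inverse mult_ac)
    ultimately show ?thesis
      unfolding F_def * by (metis cis_neq_zero)
  qed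
  moreover have "(- \<i>) * (2 * of_real pi * \<i> * x) = of_real (2 * pi) * x" for x
    by simp
  ultimately show ?thesis by (simp only:)
qed

lemma poisson_integral_Re:
  fixes f :: "complex \<Rightarrow> complex"
  assumes "f holomorphic_on cball 0 1" "cmod w < 1"
  shows "(LINT t:{0..2*pi}|lebesgue. Re (f (cis t)) * poisson w t) = 2 * pi * Re (f w)"
proof -
  have "continuous_on {0..2*pi} (\<lambda>t. f (cis t))"
    by (intro continuous_on_compose2[OF holomorphic_on_imp_continuous_on[OF assms(1)]] continuous_intros) auto
  then have "set_integrable lebesgue {0..2*pi} (\<lambda>t. Re (f (cis t)) * poisson w t)"
    using assms(2) by (intro absolutely_integrable_continuous_real continuous_intros)
  then have "(LINT t:{0..2*pi}|lebesgue. Re (f (cis t)) * poisson w t)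
      = integral {0..2*pi} (\<lambda>t. Re (f (cis t)) * poisson w t)"
    by (rule set_lebesgue_integral_eq_integral)
  also have "\<dots> = 2 * pi * Re (f w)"
    using has_integral_Re[OF poisson_integral[OF assms]] by (intro integral_unique) simp
  finally show ?thesis .
qed

section \<open>Poisson integrals of the kernel ratio and of its logarithm\<close>

lemma kernel_ratio_pos:
  assumes "cmod w < 1" "cmod (g w) < 1" "cmod \<zeta> \<le> 1" "cmod (g \<zeta>) \<le> 1"
  shows "0 < kernel_ratio g w \<zeta>"
  unfolding kernel_ratio_def
  using assms one_minus_norm_sq_pos[of w] one_minus_norm_sq_pos[of "g w"]
    one_minus_cnj_mult_neq_0[of w \<zeta>] one_minus_cnj_mult_neq_0[of "g w" "g \<zeta>"]
  by (intro mult_pos_pos divide_pos_pos) auto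

lemma continuous_on_kernel_ratio:
  assumes "continuous_on (sphere 0 1) g" "cmod w < 1"
  shows "continuous_on S (\<lambda>t. kernel_ratio g w (cis t))"
proof -
  have "continuous_on S (\<lambda>t. g (cis t))"
    by (intro continuous_on_compose2[OF assms(1)] continuous_intros) auto
  then show ?thesis
    unfolding kernel_ratio_def using assms(2)
    \<comment> \<open>If \<open>g w\<close> has modulus 1, division by zero makes the ratio
      identically 0, which is still continuous.\<close>
    by (cases "(cmod (g w))\<^sup>2 = 1") (auto intro!: continuous_intros simp: cnj_mult_neq_1)
qed

text \<open>The logarithm is the real part of the holomorphic function \<open>F\<close> built from
  principal logarithms, so Poisson's formula applies. At \<open>w\<close> the ratio is the squared
  kernel value divided by itself, that is, the kernel value, and \<open>c\<close> is minus its
  logarithm.\<close>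

lemma poisson_integral_ln_kernel_ratio:
  assumes hol: "g holomorphic_on cball 0 1" and lt: "\<And>z. z \<in> cball 0 1 \<Longrightarrow> cmod (g z) < 1"
    and w: "cmod w < 1"
  shows "(LINT t:{0..2*pi}|lebesgue. ln (kernel_ratio g w (cis t)) * poisson w t)
    = 2 * pi * ln ((1 - (cmod (g w))\<^sup>2) / (1 - (cmod w)\<^sup>2))"
proof -
  define c where "c = ln ((1 - (cmod w)\<^sup>2) / (1 - (cmod (g w))\<^sup>2))"
  define F where "F = (\<lambda>u. 2 * Ln (1 - cnj (g w) * g u) - 2 * Ln (1 - cnj w * u) + of_real c)"
  have gw: "cmod (g w) < 1" using lt w by auto
  note pos = one_minus_norm_sq_pos[OF w] one_minus_norm_sq_pos[OF gw]
  \<comment> \<open>The products have modulus below 1, so the arguments of \<open>Ln\<close> stay in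
    the right half-plane, away from the branch cut.\<close>
  have Re_pos: "1 - cnj a * u \<notin> \<real>\<^sub>\<le>\<^sub>0" if "cmod a < 1" "cmod u \<le> 1" for a u
  proof -
    have "cmod (cnj a * u) < 1"
      using that by (simp add: norm_mult) (meson le_less_trans mult_left_le norm_ge_zero)
    then have "Re (cnj a * u) < 1"
      using complex_Re_le_cmod le_less_trans by blast
    then show ?thesis
      by (auto simp: complex_nonpos_Reals_iff)
  qed
  have "F holomorphic_on cball 0 1"
    unfolding F_def using hol Re_pos[OF gw] Re_pos[OF w] lt
    by (intro holomorphic_intros) (auto simp: less_imp_le)
  then have "(LINT t:{0..2*pi}|lebesgue. Re (F (cis t)) * poisson w t) = 2 * pi * Re (F w)"
    using w by (rule poisson_integral_Re)
  moreover have "Re (F (cis t)) = ln (kernel_ratio g w (cis t))" for t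
    using pos one_minus_cnj_mult_neq_0[OF w, of "cis t"] one_minus_cnj_mult_neq_0[OF gw, of "g (cis t)"] lt[of "cis t"]
    by (simp add: F_def kernel_ratio_def ln_mult ln_div ln_realpow c_def)
  moreover have "Re (F w) = ln ((1 - (cmod (g w))\<^sup>2) / (1 - (cmod w)\<^sup>2))"
  proof -
    have *: "cmod (1 - cnj a * a) = 1 - (cmod a)\<^sup>2" if "cmod a < 1" for a
    proof -
      have "1 - cnj a * a = of_real (1 - (cmod a)\<^sup>2)"
        by (simp add: complex_norm_square[symmetric] mult.commute flip: of_real_power)
      then show ?thesis
        using one_minus_norm_sq_pos[OF that] by (simp only: norm_of_real)
    qed
    show ?thesis
      using pos one_minus_cnj_mult_neq_0[OF w, of w] one_minus_cnj_mult_neq_0[OF gw, of "g w"] w gw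
      by (simp add: F_def c_def * ln_div)
  qed
  ultimately show ?thesis by simp
qed

lemma poisson_integral_1:
  assumes "cmod w < 1"
  shows "(LINT t:{0..2*pi}|lebesgue. poisson w t) = 2 * pi"
  using poisson_integral_Re[of "\<lambda>_. 1" w] assms by auto

text \<open>With \<open>a = g w\<close> and \<open>cmod (g u) \<le> 1\<close>, the numerator
  \<open>(cmod (1 - cnj a * g u))\<^sup>2\<close> is at most
  \<open>1 + (cmod a)\<^sup>2 - 2 * Re (cnj a * g u)\<close>. This majorant is harmonic in
  \<open>u\<close> and equals \<open>1 - (cmod a)\<^sup>2\<close> at \<open>w\<close>, which cancels
  the denominator.\<close>

lemma poisson_integral_kernel_ratio_le:
  assumes hol: "g holomorphic_on cball 0 1" and lt: "\<And>z. z \<in> cball 0 1 \<Longrightarrow> cmod (g z) < 1"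
    and w: "cmod w < 1"
  shows "(LINT t:{0..2*pi}|lebesgue. kernel_ratio g w (cis t) * poisson w t)
    \<le> 2 * pi * ((1 + cmod w) / (1 - cmod w))"
proof -
  define a where "a = g w"
  define M where "M = (1 + cmod w) / (1 - cmod w)"
  define F where "F = (\<lambda>u. of_real (M / (1 - (cmod a)\<^sup>2)) * (of_real (1 + (cmod a)\<^sup>2) - 2 * (cnj a * g u)))"
  have a: "cmod a < 1" using lt w by (auto simp: a_def)
  note pa = one_minus_norm_sq_pos[OF a]
  have F: "F holomorphic_on cball 0 1"
    unfolding F_def using hol by (intro holomorphic_intros)
  have cont: "continuous_on (sphere 0 1) g" "continuous_on (sphere 0 1) F"
    using F hol by (auto intro: holomorphic_on_imp_continuous_on continuous_on_subset)
  have contF: "continuous_on {0..2*pi} (\<lambda>t. F (cis t))"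
    by (intro continuous_on_compose2[OF cont(2)] continuous_intros) auto
  have "kernel_ratio g w (cis t) \<le> Re (F (cis t))" for t
  proof -
    let ?G = "g (cis t)"
    have G: "(cmod ?G)\<^sup>2 \<le> 1" using lt[of "cis t"] by (simp add: power_le_one)
    have ReF: "Re (F (cis t)) = M / (1 - (cmod a)\<^sup>2) * (1 + (cmod a)\<^sup>2 - 2 * Re (cnj a * ?G))"
      unfolding F_def by (simp only: Re_complex_of_real times_complex.simps minus_complex.simps Im_complex_of_real) simp
    have "(cmod (1 - cnj a * ?G))\<^sup>2 = 1 + (cmod a)\<^sup>2 * (cmod ?G)\<^sup>2 - 2 * Re (cnj a * ?G)"
      unfolding cmod_power2 by (simp add: power2_eq_square algebra_simps)
    also have "\<dots> \<le> 1 + (cmod a)\<^sup>2 - 2 * Re (cnj a * ?G)"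
      using G by (simp add: mult_left_le)
    finally have N: "(cmod (1 - cnj a * ?G))\<^sup>2 \<le> 1 + (cmod a)\<^sup>2 - 2 * Re (cnj a * ?G)" .
    \<comment> \<open>The Poisson kernel inside the ratio is replaced by its maximum
      \<open>M\<close>; the second Poisson kernel in the integral is kept as the measure.\<close>
    have "kernel_ratio g w (cis t) = (cmod (1 - cnj a * ?G))\<^sup>2 / (1 - (cmod a)\<^sup>2) * poisson w t"
      by (simp add: kernel_ratio_def poisson_alt a_def)
    also have "\<dots> \<le> (1 + (cmod a)\<^sup>2 - 2 * Re (cnj a * ?G)) / (1 - (cmod a)\<^sup>2) * M"
      using N order_trans[OF zero_le_power2 N] pa poisson_le[OF w, of t] poisson_pos[OF w, of t]
      unfolding M_def by (intro mult_mono divide_right_mono divide_nonneg_nonneg) linarith+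
    finally show ?thesis by (simp add: ReF mult_ac)
  qed
  then have "(LINT t:{0..2*pi}|lebesgue. kernel_ratio g w (cis t) * poisson w t)
      \<le> (LINT t:{0..2*pi}|lebesgue. Re (F (cis t)) * poisson w t)"
    using w contF cont
    by (intro set_integral_mono absolutely_integrable_continuous_real continuous_intros
        continuous_on_kernel_ratio mult_right_mono) (auto intro: less_imp_le[OF poisson_pos])
  also have "\<dots> = 2 * pi * Re (F w)"
    using F w by (rule poisson_integral_Re)
  also have "Re (F w) = M"
  proof -
    have "cnj a * a = of_real ((cmod a)\<^sup>2)"
      by (metis complex_norm_square mult.commute of_real_power)
    then have "F w = of_real (M / (1 - (cmod a)\<^sup>2) * (1 + (cmod a)\<^sup>2 - 2 * (cmod a)\<^sup>2))"
      unfolding F_def a_def[symmetric] by (simp only: of_real_mult of_real_diff) simp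
    also have "M / (1 - (cmod a)\<^sup>2) * (1 + (cmod a)\<^sup>2 - 2 * (cmod a)\<^sup>2) = M"
      using pa by (simp add: field_simps)
    finally show ?thesis by simp
  qed
  finally show ?thesis by (simp add: M_def)
qed

section \<open>Splitting the circle and Jensen's inequality\<close>

text \<open>The Poisson integral of the logarithm is left untouched on \<open>A\<close>. On the
  complement, of harmonic measure \<open>1 - \<omega>\<close>, concavity of the logarithm and the
  bound on the integral of the ratio give the last term.\<close>

lemma ln_kernel_quotient_le_split:
  assumes hol: "g holomorphic_on cball 0 1" and lt: "\<And>z. z \<in> cball 0 1 \<Longrightarrow> cmod (g z) < 1"
    and w: "cmod w < 1" and A: "A \<in> sets lebesgue" "A \<subseteq> {0..2*pi}"
    and \<omega>: "\<omega> = (LINT t:A|lebesgue. poisson w t) / (2 * pi)"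
  shows "ln ((1 - (cmod (g w))\<^sup>2) / (1 - (cmod w)\<^sup>2))
    \<le> (LINT t:A|lebesgue. ln (kernel_ratio g w (cis t)) * poisson w t) / (2 * pi)
       + (if \<omega> = 1 then 0 else (1 - \<omega>) * ln (1 / (1 - \<omega>) * ((1 + cmod w) / (1 - cmod w))))"
proof -
  let ?I = "{0..2*pi}"
  define B where "B = ?I - A"
  define M where "M = (1 + cmod w) / (1 - cmod w)"
  define h where "h = (\<lambda>t. kernel_ratio g w (cis t))"
  have B: "B \<in> sets lebesgue" "B \<subseteq> ?I" using A by (auto simp: B_def)
  have split: "(LINT t:?I|lebesgue. f t) = (LINT t:A|lebesgue. f t) + (LINT t:B|lebesgue. f t)"
    if "set_integrable lebesgue ?I f" for f :: "real \<Rightarrow> real"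
  proof -
    have "(LINT t:A \<union> B|lebesgue. f t) = (LINT t:A|lebesgue. f t) + (LINT t:B|lebesgue. f t)"
      using A B by (intro set_integral_Un set_integrable_subset[OF that]) (auto simp: B_def)
    moreover have "A \<union> B = ?I" using A by (auto simp: B_def)
    ultimately show ?thesis by simp
  qed
  have nonneg: "0 \<le> (LINT t:S|lebesgue. f t)" if "\<And>t. 0 \<le> f t" for f :: "real \<Rightarrow> real" and S
    unfolding set_lebesgue_integral_def using that by (intro integral_nonneg_AE AE_I2) simp
  have gw: "cmod (g w) < 1" using lt w by auto
  have hpos: "0 < h t" for t
    unfolding h_def using w gw lt[of "cis t"] by (intro kernel_ratio_pos) auto
  have conth: "continuous_on ?I h"
    unfolding h_def using hol w
    by (intro continuous_on_kernel_ratio) (auto intro: holomorphic_on_imp_continuous_on continuous_on_subset)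
  have hn0: "h t \<noteq> 0" for t using hpos[of t] by simp
  have intP: "set_integrable lebesgue ?I (poisson w)"
    using w by (intro absolutely_integrable_continuous_real continuous_intros)
  have inth: "set_integrable lebesgue ?I (\<lambda>t. h t * poisson w t)"
    using w conth by (intro absolutely_integrable_continuous_real continuous_intros)
  have intln: "set_integrable lebesgue ?I (\<lambda>t. ln (h t) * poisson w t)"
    using w conth hn0 by (intro absolutely_integrable_continuous_real continuous_intros) auto
  have MB: "(LINT t:B|lebesgue. poisson w t) = 2 * pi * (1 - \<omega>)"
  proof -
    have "(LINT t:A|lebesgue. poisson w t) = 2 * pi * \<omega>" by (simp add: \<omega>)
    then show ?thesis
      using split[OF intP] poisson_integral_1[OF w] by (simp only: right_diff_distrib)
  qed
  have "0 \<le> (LINT t:B|lebesgue. poisson w t)"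
    by (intro nonneg less_imp_le[OF poisson_pos[OF w]])
  then have "0 \<le> 1 - \<omega>"
    unfolding MB using pi_gt_zero by (simp add: zero_le_mult_iff not_le)
  have intPB: "set_integrable lebesgue B (poisson w)"
    and inthB: "set_integrable lebesgue B (\<lambda>t. h t * poisson w t)"
    and intlnB: "set_integrable lebesgue B (\<lambda>t. ln (h t) * poisson w t)"
    using B by (auto intro: set_integrable_subset[OF intP] set_integrable_subset[OF inth]
        set_integrable_subset[OF intln])
  \<comment> \<open>Jensen's inequality in tangent form: \<open>ln x \<le> x / c + ln c - 1\<close>.
    Keeping the tangent point \<open>c\<close> free also covers a complement of measure
    zero.\<close>
  have bound: "(LINT t:B|lebesgue. ln (h t) * poisson w t)
      \<le> (LINT t:B|lebesgue. h t * poisson w t) / c + (ln c - 1) * (2 * pi * (1 - \<omega>))" if c: "0 < c" for c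
  proof -
    have "(LINT t:B|lebesgue. ln (h t) * poisson w t)
        \<le> (LINT t:B|lebesgue. (h t * poisson w t) / c + (ln c - 1) * poisson w t)"
    proof (intro set_integral_mono intlnB set_integral_add set_integrable_divide inthB
        set_integrable_mult_right intPB)
      fix t
      have "ln (h t / c) \<le> h t / c - 1"
        using hpos c by (intro ln_le_minus_one) simp
      then have "ln (h t) \<le> h t / c + (ln c - 1)"
        using hpos[of t] c by (simp add: ln_div)
      from mult_right_mono[OF this less_imp_le[OF poisson_pos[OF w, of t]]]
      show "ln (h t) * poisson w t \<le> (h t * poisson w t) / c + (ln c - 1) * poisson w t"
        by (simp add: algebra_simps)
    qed
    also have "\<dots> = (LINT t:B|lebesgue. h t * poisson w t) / c + (ln c - 1) * (2 * pi * (1 - \<omega>))"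
      using inthB intPB by (subst set_integral_add) (auto simp: MB)
    finally show ?thesis .
  qed
  \<comment> \<open>The integrand is positive, so discarding its part over \<open>A\<close> only
    enlarges the bound.\<close>
  have hB: "(LINT t:B|lebesgue. h t * poisson w t) \<le> 2 * pi * M"
  proof -
    have "0 \<le> (LINT t:A|lebesgue. h t * poisson w t)"
      by (intro nonneg mult_nonneg_nonneg less_imp_le[OF hpos] less_imp_le[OF poisson_pos[OF w]])
    then show ?thesis
      using split[OF inth] poisson_integral_kernel_ratio_le[OF hol lt w] by (simp add: h_def M_def)
  qed
  have Mpos: "0 < M" using w by (auto simp: M_def intro!: divide_pos_pos add_pos_nonneg)
  have "(LINT t:B|lebesgue. ln (h t) * poisson w t)
      \<le> 2 * pi * (if \<omega> = 1 then 0 else (1 - \<omega>) * ln (1 / (1 - \<omega>) * M))"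
  proof (cases "\<omega> = 1")
    \<comment> \<open>The complement has no mass, so the term with \<open>ln c\<close> vanishes; the
      tangent point \<open>2 * pi * M / e\<close> then leaves at most \<open>e\<close>.\<close>
    case True
    have "(LINT t:B|lebesgue. ln (h t) * poisson w t) \<le> e" if "0 < e" for e
    proof -
      have "(LINT t:B|lebesgue. ln (h t) * poisson w t) \<le> (LINT t:B|lebesgue. h t * poisson w t) / (2 * pi * M / e)"
        using bound[of "2 * pi * M / e"] True that Mpos by simp
      also have "\<dots> \<le> 2 * pi * M / (2 * pi * M / e)"
        using hB that Mpos by (intro divide_right_mono) auto
      finally show ?thesis using that Mpos by simp
    qed
    then show ?thesis
      using True by (simp add: field_le_epsilon)
  next
    case False
    then have th: "0 < 1 - \<omega>" using \<open>0 \<le> 1 - \<omega>\<close> by simp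
    \<comment> \<open>This tangent point minimises
      \<open>2 * pi * M / c + (ln c - 1) * (2 * pi * (1 - \<omega>))\<close>; it is the upper bound
      for the mean of \<open>h\<close> over \<open>B\<close>.\<close>
    define c where "c = M / (1 - \<omega>)"
    have c: "0 < c" using th Mpos by (simp add: c_def)
    have "(LINT t:B|lebesgue. h t * poisson w t) / c \<le> 2 * pi * M / c"
      using hB c by (intro divide_right_mono) auto
    also have "\<dots> = 2 * pi * (1 - \<omega>)"
      using Mpos th by (simp add: c_def)
    finally have "(LINT t:B|lebesgue. ln (h t) * poisson w t) \<le> 2 * pi * (1 - \<omega>) + (ln c - 1) * (2 * pi * (1 - \<omega>))"
      using bound[OF c] by linarith
    also have "\<dots> = 2 * pi * ((1 - \<omega>) * ln c)"
      by (simp add: algebra_simps)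
    finally show ?thesis using False by (simp add: c_def)
  qed
  moreover have "2 * pi * ln ((1 - (cmod (g w))\<^sup>2) / (1 - (cmod w)\<^sup>2))
      = (LINT t:A|lebesgue. ln (h t) * poisson w t) + (LINT t:B|lebesgue. ln (h t) * poisson w t)"
    using split[OF intln] poisson_integral_ln_kernel_ratio[OF hol lt w] by (simp add: h_def)
  ultimately have "2 * pi * ln ((1 - (cmod (g w))\<^sup>2) / (1 - (cmod w)\<^sup>2))
      \<le> 2 * pi * ((LINT t:A|lebesgue. ln (h t) * poisson w t) / (2 * pi)
         + (if \<omega> = 1 then 0 else (1 - \<omega>) * ln (1 / (1 - \<omega>) * M)))"
    by (simp add: distrib_left)
  then show ?thesis
    by (simp only: mult_le_cancel_left_pos pi_gt_zero mult_pos_pos zero_less_numeral h_def M_def)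
qed

section \<open>The Schwarz--Pick inequality in kernel form\<close>

lemma one_minus_norm_Moebius_function_sq:
  assumes "cmod w < 1" "cmod z < 1"
  shows "1 - (cmod (Moebius_function 0 w z))\<^sup>2
    = (1 - (cmod w)\<^sup>2) * (1 - (cmod z)\<^sup>2) / (cmod (1 - cnj w * z))\<^sup>2"
proof -
  have "(cmod (1 - cnj w * z))\<^sup>2 - (cmod (z - w))\<^sup>2 = (1 - (cmod w)\<^sup>2) * (1 - (cmod z)\<^sup>2)"
    unfolding cmod_power2 by (simp add: power2_eq_square algebra_simps)
  moreover have "cmod (1 - cnj w * z) \<noteq> 0"
    using one_minus_cnj_mult_neq_0[of w z] assms by simp
  ultimately show ?thesis
    by (simp add: Moebius_function_simple norm_divide power_divide field_simps)
qed

text \<open>Disc automorphisms move \<open>u\<close> and \<open>f u\<close> to the origin, turning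
  \<open>f\<close> into \<open>G\<close> with \<open>G 0 = 0\<close>. Schwarz's lemma for
  \<open>G\<close> at the image \<open>\<xi>\<close> of \<open>v\<close> gives the claim once the
  moduli are rewritten as products of \<open>1 - (cmod _)\<^sup>2\<close>.\<close>

lemma Schwarz_Pick:
  assumes hol: "f holomorphic_on ball 0 1" and lt: "\<And>z. z \<in> ball 0 1 \<Longrightarrow> cmod (f z) < 1"
    and u: "cmod u < 1" and v: "cmod v < 1"
  shows "(cmod (1 - cnj (f u) * f v))\<^sup>2 / (cmod (1 - cnj u * v))\<^sup>2
    \<le> (1 - (cmod (f u))\<^sup>2) / (1 - (cmod u)\<^sup>2) * ((1 - (cmod (f v))\<^sup>2) / (1 - (cmod v)\<^sup>2))"
proof -
  define G where "G = Moebius_function 0 (f u) \<circ> f \<circ> Moebius_function 0 (- u)"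
  define \<xi> where "\<xi> = Moebius_function 0 u v"
  have fu: "cmod (f u) < 1" and fv: "cmod (f v) < 1" using lt u v by auto
  have mu: "Moebius_function 0 (-u) ` ball 0 1 \<subseteq> ball 0 1"
    using Moebius_function_norm_lt_1[of "- u"] u by auto
  have "cmod (G \<xi>) \<le> cmod \<xi>"
  proof (rule Schwarz_Lemma(1))
    show "G holomorphic_on ball 0 1"
      unfolding G_def using u fu lt mu hol
      by (intro holomorphic_on_compose_gen[OF Moebius_function_holomorphic]
          holomorphic_on_compose_gen[OF _ hol] holomorphic_on_compose_gen[OF _ Moebius_function_holomorphic]) auto
    show "G 0 = 0"
      by (simp add: G_def Moebius_function_of_zero Moebius_function_eq_zero)
    show "cmod (G z) < 1" if "cmod z < 1" for z
    proof -
      have "Moebius_function 0 (- u) z \<in> ball 0 1"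
        using mu that by (meson image_subset_iff mem_ball_0)
      then show ?thesis
        unfolding G_def comp_def by (intro Moebius_function_norm_lt_1 fu lt)
    qed
    show "cmod \<xi> < 1"
      unfolding \<xi>_def using u v by (rule Moebius_function_norm_lt_1)
  qed
  moreover have "G \<xi> = Moebius_function 0 (f u) (f v)"
    using u v by (simp add: G_def \<xi>_def Moebius_function_compose)
  ultimately have "1 - (cmod \<xi>)\<^sup>2 \<le> 1 - (cmod (Moebius_function 0 (f u) (f v)))\<^sup>2"
    by (simp add: power_mono)
  then have *: "(1 - (cmod u)\<^sup>2) * (1 - (cmod v)\<^sup>2) / (cmod (1 - cnj u * v))\<^sup>2
    \<le> (1 - (cmod (f u))\<^sup>2) * (1 - (cmod (f v))\<^sup>2) / (cmod (1 - cnj (f u) * f v))\<^sup>2"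
    unfolding \<xi>_def using u v fu fv by (simp add: one_minus_norm_Moebius_function_sq)
  have swap: "q / b \<le> p / a" if "a / b \<le> p / q" "0 < a" "0 < b" "0 < q" for a b p q :: real
    using that by (simp add: field_simps)
  have pos: "0 < (cmod (1 - cnj u * v))\<^sup>2" "0 < (cmod (1 - cnj (f u) * f v))\<^sup>2"
    using one_minus_cnj_mult_neq_0[of u v] one_minus_cnj_mult_neq_0[of "f u" "f v"] u v fu fv by auto
  show ?thesis
    using swap[OF * mult_pos_pos[OF one_minus_norm_sq_pos[OF u] one_minus_norm_sq_pos[OF v]] pos]
    by (simp add: mult_ac)
qed

section \<open>Radial behaviour at points with an angular derivative\<close>

text \<open>For \<open>0 < r < 1\<close> the distance from \<open>r * \<zeta>\<close> to
  \<open>\<zeta>\<close> is exactly \<open>1 - r\<close>, so the radius lies in every Stolz region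
  with \<open>\<alpha> > 1\<close>.\<close>

lemma filterlim_radius_stolz:
  assumes "cmod \<zeta> = 1" "1 < \<alpha>"
  shows "filterlim (\<lambda>r. of_real r * \<zeta>) (at \<zeta> within stolz \<alpha> \<zeta>) (at_left 1)"
  unfolding filterlim_at
proof
  show "\<forall>\<^sub>F r in at_left 1. of_real r * \<zeta> \<in> stolz \<alpha> \<zeta> \<and> of_real r * \<zeta> \<noteq> \<zeta>"
    using eventually_at_left_real[of 0 1, simplified]
  proof eventually_elim
    case (elim r)
    have "of_real r * \<zeta> - \<zeta> = of_real (r - 1) * \<zeta>" by (simp add: algebra_simps)
    then have "cmod (of_real r * \<zeta> - \<zeta>) = 1 - r"
      using elim assms by (simp only: norm_mult norm_of_real) simp
    then show ?case
      using elim assms by (auto simp: stolz_def norm_mult)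
  qed
  have "((\<lambda>r. of_real r * \<zeta>) \<longlongrightarrow> of_real 1 * \<zeta>) (at_left (1::real))"
    by (intro tendsto_intros)
  then show "((\<lambda>r. of_real r * \<zeta>) \<longlongrightarrow> \<zeta>) (at_left (1::real))" by simp
qed

lemma nt_limit_radial:
  assumes "nt_limit f \<zeta> L" "cmod \<zeta> = 1"
  shows "((\<lambda>r. f (of_real r * \<zeta>)) \<longlongrightarrow> L) (at_left 1)"
proof (rule filterlim_compose[OF _ filterlim_radius_stolz[of \<zeta> 2]])
  show "(f \<longlongrightarrow> L) (at \<zeta> within stolz 2 \<zeta>)"
    using assms(1) by (simp add: nt_limit_def)
qed (use assms in auto)

text \<open>Two nontangential limits agree because both are the radial limit; this makes the
  definite description usable.\<close>

lemma angular_derivative_eqI: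
  assumes "nt_limit (deriv \<phi>) \<zeta> D" "cmod \<zeta> = 1"
  shows "angular_derivative \<phi> \<zeta> = D"
  unfolding angular_derivative_def
  using assms by (intro the_equality) (auto intro: tendsto_unique[OF _ nt_limit_radial nt_limit_radial])

text \<open>Near the end of the radius the derivative is below \<open>\<eta>\<close>, so the mean
  value inequality up to the boundary value \<open>L\<close> gives
  \<open>1 - cmod (\<phi> (r * \<zeta>)) \<le> \<eta> * (1 - r)\<close>. The factor
  \<open>2 / (1 + r)\<close> comes from \<open>1 + cmod (\<phi> (r * \<zeta>)) \<le> 2\<close> and
  the factorisation of \<open>1 - r\<^sup>2\<close>.\<close>

lemma eventually_boundary_quotient_le:
  assumes hol: "\<phi> holomorphic_on ball 0 1" and lt: "\<And>z. z \<in> ball 0 1 \<Longrightarrow> cmod (\<phi> z) < 1"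
    and ang: "has_angular_derivative \<phi> \<zeta>" and \<zeta>: "cmod \<zeta> = 1"
    and \<eta>: "cmod (angular_derivative \<phi> \<zeta>) < \<eta>"
  shows "\<forall>\<^sub>F r in at_left 1. (1 - (cmod (\<phi> (of_real r * \<zeta>)))\<^sup>2) / (1 - r\<^sup>2) \<le> 2 / (1 + r) * \<eta>"
proof -
  obtain L D where L: "nt_limit \<phi> \<zeta> L" "cmod L = 1" and D: "nt_limit (deriv \<phi>) \<zeta> D"
    using ang by (auto simp: has_angular_derivative_def)
  have "((\<lambda>r. cmod (deriv \<phi> (of_real r * \<zeta>))) \<longlongrightarrow> cmod D) (at_left 1)"
    by (intro tendsto_norm nt_limit_radial D \<zeta>)
  then have "\<forall>\<^sub>F r in at_left 1. cmod (deriv \<phi> (of_real r * \<zeta>)) < \<eta>"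
    using \<eta> angular_derivative_eqI[OF D \<zeta>] by (auto dest: order_tendstoD)
  then obtain b where b: "b < 1" "\<And>r. b < r \<Longrightarrow> r < 1 \<Longrightarrow> cmod (deriv \<phi> (of_real r * \<zeta>)) < \<eta>"
    unfolding eventually_at_left[OF zero_less_one] by blast
  have nrm: "cmod (of_real r * \<zeta>) = r" if "0 < r" for r using that \<zeta> by (simp add: norm_mult)
  have "\<forall>\<^sub>F r in at_left 1. r \<in> {max 0 b<..<1}"
    using b(1) by (intro eventually_at_left_real) simp
  then show ?thesis
  proof eventually_elim
    case r: (elim r)
    have lip: "cmod (\<phi> (of_real s * \<zeta>) - \<phi> (of_real r * \<zeta>)) \<le> \<eta> * (s - r)" if s: "r \<le> s" "s < 1" for s
    proof -
      define T where "T = (\<lambda>x. of_real x * \<zeta>) ` {r..s}"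
      have "convex T"
        unfolding T_def
        by (intro convex_linear_image) (auto intro!: bounded_linear.linear bounded_linear_mult_const bounded_linear_of_real)
      moreover have "(\<phi> has_field_derivative deriv \<phi> z) (at z within T)" "cmod (deriv \<phi> z) \<le> \<eta>" if zT: "z \<in> T" for z
      proof -
        obtain x where x: "z = of_real x * \<zeta>" "r \<le> x" "x \<le> s" using zT unfolding T_def by force
        then have "z \<in> ball 0 1" using r s nrm[of x] by auto
        then show "(\<phi> has_field_derivative deriv \<phi> z) (at z within T)"
          using holomorphic_derivI[OF hol] by (auto intro: has_field_derivative_at_within)
        show "cmod (deriv \<phi> z) \<le> \<eta>" using b(2)[of x] x r s by auto
      qed
      ultimately have "cmod (\<phi> (of_real s * \<zeta>) - \<phi> (of_real r * \<zeta>)) \<le> \<eta> * cmod (of_real s * \<zeta> - of_real r * \<zeta>)"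
        using s r by (intro field_differentiable_bound[of T \<phi> "deriv \<phi>"]) (auto simp: T_def)
      also have "of_real s * \<zeta> - of_real r * \<zeta> = of_real (s - r) * \<zeta>" by (simp add: algebra_simps)
      also have "cmod \<dots> = s - r" using s \<zeta> by (simp only: norm_mult norm_of_real) simp
      finally show ?thesis .
    qed
    \<comment> \<open>The Lipschitz bound between interior points passes to the boundary as
      \<open>s\<close> tends to 1.\<close>
    have "cmod (L - \<phi> (of_real r * \<zeta>)) \<le> \<eta> * (1 - r)"
    proof (rule tendsto_le)
      show "((\<lambda>s. \<eta> * (s - r)) \<longlongrightarrow> \<eta> * (1 - r)) (at_left 1)"
        by (intro tendsto_intros)
      show "((\<lambda>s. cmod (\<phi> (of_real s * \<zeta>) - \<phi> (of_real r * \<zeta>))) \<longlongrightarrow> cmod (L - \<phi> (of_real r * \<zeta>))) (at_left 1)"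
        by (intro tendsto_intros nt_limit_radial L \<zeta>)
      show "\<forall>\<^sub>F s in at_left 1. cmod (\<phi> (of_real s * \<zeta>) - \<phi> (of_real r * \<zeta>)) \<le> \<eta> * (s - r)"
        using eventually_at_left_real[of r 1] r by (auto elim!: eventually_mono intro: lip)
    qed auto
    then have 1: "1 - cmod (\<phi> (of_real r * \<zeta>)) \<le> \<eta> * (1 - r)"
      using norm_triangle_ineq2[of L "\<phi> (of_real r * \<zeta>)"] L by linarith
    have lt1: "cmod (\<phi> (of_real r * \<zeta>)) < 1" using lt r nrm[of r] by auto
    have "1 - (cmod (\<phi> (of_real r * \<zeta>)))\<^sup>2 = (1 - cmod (\<phi> (of_real r * \<zeta>))) * (1 + cmod (\<phi> (of_real r * \<zeta>)))"
      by (simp add: power2_eq_square algebra_simps)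
    also have "\<dots> \<le> (\<eta> * (1 - r)) * 2"
      using 1 lt1 by (intro mult_mono) auto
    finally have 2: "1 - (cmod (\<phi> (of_real r * \<zeta>)))\<^sup>2 \<le> 2 * \<eta> * (1 - r)" by simp
    have "1 - r\<^sup>2 = (1 + r) * (1 - r)" by (simp add: power2_eq_square algebra_simps)
    then have "(1 - (cmod (\<phi> (of_real r * \<zeta>)))\<^sup>2) / (1 - r\<^sup>2) \<le> (2 * \<eta> * (1 - r)) / ((1 + r) * (1 - r))"
      using 2 r by (simp only:) (intro divide_right_mono, auto)
    also have "\<dots> = 2 * \<eta> / (1 + r)" using r by simp
    finally show ?case by simp
  qed
qed

section \<open>Uniform bounds and boundary limits of the kernel ratio\<close>

text \<open>The bound depends on \<open>g\<close> only through \<open>\<rho>\<close>, so one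
  constant serves all dilations of \<phi> and supplies a dominating function. The 4 is the square of
  the bound 2 for \<open>1 - cnj (g w) * g (cis t)\<close>.\<close>

lemma kernel_ratio_le:
  assumes w: "cmod w < 1" and \<rho>: "cmod (g w) \<le> \<rho>" "\<rho> < 1" and g: "cmod (g (cis t)) \<le> 1"
  shows "kernel_ratio g w (cis t) \<le> 4 / (1 - \<rho>\<^sup>2) * ((1 + cmod w) / (1 - cmod w))"
proof -
  have \<rho>0: "0 \<le> \<rho>" using \<rho>(1) norm_ge_zero order_trans by blast
  have "\<rho>\<^sup>2 < 1" using \<rho>0 \<rho>(2) by (simp add: power_less_one_iff)
  have "cmod (1 - cnj (g w) * g (cis t)) \<le> 2"
    using norm_one_minus_cnj_mult_le[OF g, of "g w"] \<rho> by simp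
  then have "(cmod (1 - cnj (g w) * g (cis t)))\<^sup>2 \<le> 2\<^sup>2"
    by (intro power_mono) auto
  moreover have "(cmod (g w))\<^sup>2 \<le> \<rho>\<^sup>2" using \<rho>(1) by (intro power_mono) auto
  ultimately have "(cmod (1 - cnj (g w) * g (cis t)))\<^sup>2 / (1 - (cmod (g w))\<^sup>2) \<le> 4 / (1 - \<rho>\<^sup>2)"
    using \<open>\<rho>\<^sup>2 < 1\<close> by (intro frac_le) auto
  then show ?thesis
    unfolding kernel_ratio_def poisson_alt[symmetric]
    using poisson_le[OF w, of t] poisson_pos[OF w, of t] \<open>\<rho>\<^sup>2 < 1\<close>
    by (intro mult_mono) auto
qed

text \<open>A positive bound uniform over the dilations; it later forces the angular derivative to
  be nonzero. The first factor is at least its numerator because its denominator is at most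
  1.\<close>

lemma kernel_ratio_ge:
  assumes w: "cmod w < 1" and \<rho>: "cmod (g w) \<le> \<rho>" "\<rho> < 1"
    and \<zeta>: "cmod \<zeta> \<le> 1" "cmod (g \<zeta>) \<le> 1"
  shows "(1 - \<rho>)\<^sup>2 * ((1 - (cmod w)\<^sup>2) / (1 + cmod w)\<^sup>2) \<le> kernel_ratio g w \<zeta>"
  unfolding kernel_ratio_def
proof (rule mult_mono)
  have gw: "cmod (g w) < 1" using \<rho> by simp
  have "(1 - \<rho>)\<^sup>2 \<le> (cmod (1 - cnj (g w) * g \<zeta>))\<^sup>2"
    using norm_one_minus_cnj_mult_ge[OF \<zeta>(2), of "g w"] \<rho> by (intro power_mono) auto
  also have "\<dots> \<le> \<dots> / (1 - (cmod (g w))\<^sup>2)"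
    using one_minus_norm_sq_pos[OF gw] by (simp add: pos_le_divide_eq mult_left_le)
  finally show "(1 - \<rho>)\<^sup>2 \<le> (cmod (1 - cnj (g w) * g \<zeta>))\<^sup>2 / (1 - (cmod (g w))\<^sup>2)" .
  show "(1 - (cmod w)\<^sup>2) / (1 + cmod w)\<^sup>2 \<le> (1 - (cmod w)\<^sup>2) / (cmod (1 - cnj w * \<zeta>))\<^sup>2"
    using norm_one_minus_cnj_mult_le[OF \<zeta>(1), of w] one_minus_norm_sq_pos[OF w] cnj_mult_neq_1[OF w \<zeta>(1)]
    by (intro divide_left_mono power_mono mult_pos_pos zero_less_power) (auto simp: add_pos_nonneg)
  show "0 \<le> (cmod (1 - cnj (g w) * g \<zeta>))\<^sup>2 / (1 - (cmod (g w))\<^sup>2)"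
    using one_minus_norm_sq_pos[OF gw] by simp
  show "0 \<le> (1 - (cmod w)\<^sup>2) / (1 + cmod w)\<^sup>2"
    using one_minus_norm_sq_pos[OF w] by simp
qed

text \<open>Schwarz--Pick for \<phi> at \<open>r * w\<close> and \<open>r * \<zeta>\<close> bounds
  the ratio by the boundary quotient at \<open>r * \<zeta>\<close> times a factor tending to
  1.\<close>

lemma eventually_kernel_ratio_less:
  assumes hol: "\<phi> holomorphic_on ball 0 1" and lt: "\<And>z. z \<in> ball 0 1 \<Longrightarrow> cmod (\<phi> z) < 1"
    and w: "cmod w < 1"
    and ang: "has_angular_derivative \<phi> \<zeta>" and \<zeta>: "cmod \<zeta> = 1"
    and \<eta>: "cmod (angular_derivative \<phi> \<zeta>) < \<eta>"
  shows "\<forall>\<^sub>F r in at_left 1. kernel_ratio (\<lambda>z. \<phi> (of_real r * z)) w \<zeta> < \<eta>"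
proof -
  define P where "P = (1 - (cmod w)\<^sup>2) / (cmod (1 - cnj w * \<zeta>))\<^sup>2"
  \<comment> \<open>The correction for dilation: Schwarz--Pick involves the points
    \<open>r * w\<close> and \<open>r * \<zeta>\<close>, while the ratio has the denominators of
    \<open>w\<close> and \<open>\<zeta>\<close>. At \<open>r = 1\<close> it equals 1.\<close>
  define V where "V = (\<lambda>r. (cmod (1 - cnj (of_real r * w) * (of_real r * \<zeta>)))\<^sup>2 / (1 - (cmod (of_real r * w))\<^sup>2) * P)"
  \<comment> \<open>The gap between \<open>\<eta>'\<close> and \<open>\<eta>\<close> absorbs the
    factors \<open>V r\<close> and \<open>2 / (1 + r)\<close>, which tend to 1.\<close>
  obtain \<eta>' where \<eta>': "cmod (angular_derivative \<phi> \<zeta>) < \<eta>'" "\<eta>' < \<eta>"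
    using dense[OF \<eta>] by blast
  have nz: "1 - (cmod w)\<^sup>2 \<noteq> 0" "cmod (1 - cnj w * \<zeta>) \<noteq> 0"
    using one_minus_norm_sq_pos[OF w] one_minus_cnj_mult_neq_0[OF w, of \<zeta>] \<zeta> by auto
  have P0: "0 \<le> P" using one_minus_norm_sq_pos[OF w] by (simp add: P_def)
  have "((\<lambda>r. V r * (2 / (1 + r) * \<eta>')) \<longlongrightarrow>
      ((cmod (1 - cnj (of_real 1 * w) * (of_real 1 * \<zeta>)))\<^sup>2 / (1 - (cmod (of_real 1 * w))\<^sup>2) * P) * (2 / (1 + 1) * \<eta>')) (at_left 1)"
    unfolding V_def using nz by (intro tendsto_intros) auto
  also have "((cmod (1 - cnj (of_real 1 * w) * (of_real 1 * \<zeta>)))\<^sup>2 / (1 - (cmod (of_real 1 * w))\<^sup>2) * P) * (2 / (1 + 1) * \<eta>') = \<eta>'"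
    using nz by (simp add: P_def)
  finally have "\<forall>\<^sub>F r in at_left 1. V r * (2 / (1 + r) * \<eta>') < \<eta>"
    using \<eta>'(2) by (rule order_tendstoD)
  moreover have "\<forall>\<^sub>F r in at_left (1::real). r \<in> {0<..<1}"
    by (rule eventually_at_left_real) simp
  moreover have "\<forall>\<^sub>F r in at_left 1. (1 - (cmod (\<phi> (of_real r * \<zeta>)))\<^sup>2) / (1 - r\<^sup>2) \<le> 2 / (1 + r) * \<eta>'"
    by (intro eventually_boundary_quotient_le hol lt ang \<zeta> \<eta>'(1))
  ultimately show ?thesis
  proof eventually_elim
    case (elim r)
    have rw: "cmod (of_real r * w) < 1"
      using elim w mult_strict_mono[of r 1 "cmod w" 1] by (simp add: norm_mult)
    have r\<zeta>: "cmod (of_real r * \<zeta>) = r" using elim \<zeta> by (simp add: norm_mult)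
    define a where "a = \<phi> (of_real r * w)"
    define b where "b = \<phi> (of_real r * \<zeta>)"
    define K where "K = (1 - (cmod b)\<^sup>2) / (1 - r\<^sup>2)"
    define N where "N = (cmod (1 - cnj (of_real r * w) * (of_real r * \<zeta>)))\<^sup>2"
    define m where "m = 1 - (cmod (of_real r * w))\<^sup>2"
    have a: "0 < 1 - (cmod a)\<^sup>2" unfolding a_def using rw by (intro one_minus_norm_sq_pos lt) simp
    have m: "0 < m" unfolding m_def by (rule one_minus_norm_sq_pos[OF rw])
    have "cmod (of_real r * \<zeta>) \<le> 1" using r\<zeta> elim by auto
    from one_minus_cnj_mult_neq_0[OF rw this] have N: "0 < N" by (simp add: N_def)
    have "(cmod (1 - cnj a * b))\<^sup>2 / N \<le> (1 - (cmod a)\<^sup>2) / m * K"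
      using Schwarz_Pick[OF hol lt rw, of "of_real r * \<zeta>"] r\<zeta> elim
      by (simp only: a_def b_def N_def m_def K_def) auto
    then have "(cmod (1 - cnj a * b))\<^sup>2 / (1 - (cmod a)\<^sup>2) \<le> N / m * K"
      using N a m by (simp add: field_simps)
    then have "kernel_ratio (\<lambda>z. \<phi> (of_real r * z)) w \<zeta> \<le> N / m * K * P"
      unfolding kernel_ratio_def P_def[symmetric] a_def[symmetric] b_def[symmetric]
      using P0 by (intro mult_right_mono)
    also have "\<dots> = V r * K" by (simp add: V_def N_def m_def)
    also have "\<dots> \<le> V r * (2 / (1 + r) * \<eta>')"
    proof (rule mult_left_mono)
      show "K \<le> 2 / (1 + r) * \<eta>'" using elim(3) by (simp add: K_def b_def)
      show "0 \<le> V r" unfolding V_def N_def[symmetric] m_def[symmetric] using N m P0 by simp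
    qed
    finally show ?case using elim(1) by simp
  qed
qed

section \<open>Strict contractivity and the modulus of the outer function\<close>

lemma norm_less_1_if_nonconstant:
  assumes hol: "\<phi> holomorphic_on ball 0 1" and bnd: "\<forall>z\<in>ball 0 1. cmod (\<phi> z) \<le> 1"
    and noncst: "\<not> (\<exists>c. \<forall>z\<in>ball 0 1. \<phi> z = c)" and z: "z \<in> ball 0 1"
  shows "cmod (\<phi> z) < 1"
proof (rule ccontr)
  assume "\<not> cmod (\<phi> z) < 1"
  then have "cmod (\<phi> z) = 1" using bnd z by fastforce
  then have "\<phi> constant_on ball 0 1"
    using bnd z by (intro maximum_modulus_principle[OF hol, of "ball 0 1" z]) auto
  then show False using noncst by (auto simp: constant_on_def)
qed

text \<open>The modulus of an exponential depends on the real part of the exponent, and the Herglotz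
  kernel has the Poisson kernel as real part. Off \<open>E\<close> the prescribed modulus is 1,
  whose logarithm contributes nothing.\<close>

lemma norm_outer_function:
  assumes z: "cmod z < 1" and A: "arcs E \<in> sets lebesgue"
    and int: "set_integrable lebesgue (arcs E) (\<lambda>t. ln (d (cis t)))"
  shows "cmod (outer_function (\<lambda>\<zeta>. if \<zeta> \<in> E then d \<zeta> else 1) z)
    = exp ((LINT t:arcs E|lebesgue. ln (d (cis t)) * poisson z t) / (2 * pi))"
proof -
  define H where "H = (\<lambda>t. (cis t + z) / (cis t - z))"
  define l where "l = (\<lambda>t. indicator (arcs E) t *\<^sub>R ln (d (cis t)))"
  have ne: "cis t - z \<noteq> 0" for t using z by auto
  have l: "integrable lebesgue l" using int by (simp add: set_integrable_def l_def)
  have "continuous_on UNIV H"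
    unfolding H_def using ne by (intro continuous_intros) auto
  then have H: "H \<in> borel_measurable lebesgue"
    by (intro measurable_completion) (simp add: borel_measurable_continuous_onI)
  have ReH: "Re (H t) = poisson z t" for t
    unfolding H_def by (rule Re_herglotz_kernel)
  have Hle: "cmod (H t) \<le> 2 / (1 - cmod z)" for t
  proof -
    have "cmod (cis t + z) \<le> 2" using norm_triangle_ineq[of "cis t" z] z by simp
    moreover have "1 - cmod z \<le> cmod (cis t - z)" using norm_triangle_ineq2[of "cis t" z] by simp
    ultimately show ?thesis
      unfolding H_def norm_divide using z by (intro frac_le) auto
  qed
  have "integrable lebesgue (\<lambda>t. 2 / (1 - cmod z) * l t)" using l by simp
  \<comment> \<open>Integrability, from boundedness of \<open>H\<close>, justifies taking the real
    part under the integral.\<close>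
  then have int2: "integrable lebesgue (\<lambda>t. H t * of_real (l t))"
  proof (rule Bochner_Integration.integrable_bound)
    have [measurable]: "l \<in> borel_measurable lebesgue" using l by auto
    note H [measurable]
    show "(\<lambda>t. H t * of_real (l t)) \<in> borel_measurable lebesgue" by measurable
    show "AE t in lebesgue. norm (H t * of_real (l t)) \<le> norm (2 / (1 - cmod z) * l t)"
    proof (rule AE_I2)
      fix t
      show "norm (H t * of_real (l t)) \<le> norm (2 / (1 - cmod z) * l t)"
        using mult_right_mono[OF Hle[of t], of "\<bar>l t\<bar>"] z by (simp add: norm_mult abs_mult)
    qed
  qed
  have "(LINT t:{0..2*pi}|lebesgue. ((cis t + z) / (cis t - z)) *
      complex_of_real (ln (if cis t \<in> E then d (cis t) else 1))) = (LINT t|lebesgue. H t * of_real (l t))"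
    unfolding set_lebesgue_integral_def
    by (intro Bochner_Integration.integral_cong) (auto simp: H_def l_def arcs_def indicator_def scaleR_conv_of_real)
  moreover have "Re (LINT t|lebesgue. H t * of_real (l t)) = (LINT t|lebesgue. Re (H t * of_real (l t)))"
    using integral_Re[OF int2] by (rule sym)
  moreover have "(LINT t|lebesgue. Re (H t * of_real (l t))) = (LINT t:arcs E|lebesgue. ln (d (cis t)) * poisson z t)"
    unfolding set_lebesgue_integral_def
    by (intro Bochner_Integration.integral_cong) (auto simp: l_def ReH)
  ultimately show ?thesis
    by (simp only: outer_function_def norm_exp_eq_Re Re_divide_of_real)
qed

section \<open>Dilation and passage to the limit\<close>

theorem theorem1:
  fixes \<phi> :: "complex \<Rightarrow> complex" and E :: "complex set"
  assumes hol: "\<phi> holomorphic_on ball 0 1"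
    and bnd: "\<forall>z\<in>ball 0 1. cmod (\<phi> z) \<le> 1"
    and norm1: "(SUP z\<in>ball 0 1. cmod (\<phi> z)) = 1"
    and noncst: "\<not> (\<exists>c. \<forall>z\<in>ball 0 1. \<phi> z = c)"
    and Esub: "E \<subseteq> sphere 0 1"
    and Emeas: "arcs E \<in> sets lebesgue"
    and angE: "AE t in lebesgue. t \<in> arcs E \<longrightarrow> has_angular_derivative \<phi> (cis t)"
    and logL1: "set_integrable lebesgue (arcs E)
                  (\<lambda>t. ln (cmod (angular_derivative \<phi> (cis t))))"
    and z: "z \<in> ball 0 1"
  shows "(1 - (cmod (\<phi> z))\<^sup>2) / (1 - (cmod z)\<^sup>2)
         \<le> cmod (outer_function
                   (\<lambda>\<zeta>. (if \<zeta> \<in> E then cmod (angular_derivative \<phi> \<zeta>) else 1)) z)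
           * (if harmonic_measure z E = 1 then 1
              else ((1 / (1 - harmonic_measure z E)) * ((1 + cmod z) / (1 - cmod z)))
                     powr (1 - harmonic_measure z E))"
proof -
  define A where "A = arcs E"
  define \<omega> where "\<omega> = harmonic_measure z E"
  define M where "M = (1 + cmod z) / (1 - cmod z)"
  \<comment> \<open>The logarithm of the bracketed power, with 0 matching the convention that the
    factor is 1 when \<open>\<omega> = 1\<close>.\<close>
  define R where "R = (if \<omega> = 1 then 0 else (1 - \<omega>) * ln (1 / (1 - \<omega>) * M))"
  define L where "L = (\<lambda>t. ln (cmod (angular_derivative \<phi> (cis t))))"
  \<comment> \<open>Halving the reciprocal makes the sequence start at 1/2, so every dilation factor
    is positive.\<close>
  define r :: "nat \<Rightarrow> real" where "r = (\<lambda>n. 1 - inverse (real (Suc n)) / 2)"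
  define g where "g = (\<lambda>n u. \<phi> (of_real (r n) * u))"
  define h where "h = (\<lambda>n t. kernel_ratio (g n) z (cis t))"
  have nz: "cmod z < 1" using z by simp
  note lt = norm_less_1_if_nonconstant[OF hol bnd noncst]
  have r: "0 < r n" "r n < 1" for n
    using inverse_le_1_iff[of "real (Suc n)"] by (auto simp: r_def)
  have "r \<longlonglongrightarrow> 1 - 0 / 2"
    unfolding r_def by (intro tendsto_intros LIMSEQ_inverse_real_of_nat) auto
  then have rlim: "filterlim r (at_left 1) sequentially"
    unfolding filterlim_at using r by (auto intro!: always_eventually simp: less_imp_neq)
  have norm_scale: "cmod (of_real (r n) * u) = r n * cmod u" for n u
    using r[of n] by (simp add: norm_mult)
  have scale_le: "cmod (of_real (r n) * u) \<le> cmod u" for n u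
    using r[of n] mult_right_mono[of "r n" 1 "cmod u"] by (simp add: norm_scale)
  have scale_ball: "of_real (r n) * u \<in> ball 0 1" if "u \<in> cball 0 1" for n and u :: complex
  proof -
    have "r n * cmod u \<le> r n * 1" using r[of n] that by (intro mult_left_mono) auto
    then have "r n * cmod u < 1" using r(2)[of n] by linarith
    then show ?thesis by (simp only: mem_ball_0 norm_scale)
  qed
  have ghol: "g n holomorphic_on cball 0 1" for n
    unfolding g_def using scale_ball by (intro holomorphic_on_compose_gen[OF _ hol, unfolded comp_def] holomorphic_intros) auto
  have glt: "cmod (g n u) < 1" if "u \<in> cball 0 1" for n u
    unfolding g_def using scale_ball[OF that] by (rule lt)
  \<comment> \<open>All points \<open>r n * z\<close> lie in the compact disc of radius
    \<open>cmod z\<close>; the maximum of the modulus of \<phi> there is attained, hence below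
    1.\<close>
  obtain \<rho> where \<rho>: "\<And>n. cmod (g n z) \<le> \<rho>" "\<rho> < 1" "0 \<le> \<rho>"
  proof -
    have sub: "cball 0 (cmod z) \<subseteq> ball 0 1" using nz by auto
    have "continuous_on (cball 0 (cmod z)) (\<lambda>u. cmod (\<phi> u))"
      by (intro continuous_on_norm continuous_on_subset[OF holomorphic_on_imp_continuous_on[OF hol] sub])
    then obtain y where y: "y \<in> cball 0 (cmod z)" "\<And>u. u \<in> cball 0 (cmod z) \<Longrightarrow> cmod (\<phi> u) \<le> cmod (\<phi> y)"
      using continuous_attains_sup[of "cball 0 (cmod z)" "\<lambda>u. cmod (\<phi> u)"] by auto
    moreover have "cmod (\<phi> y) < 1" using y(1) sub by (intro lt) blast
    ultimately show ?thesis
      using scale_le[of _ z] by (intro that[of "cmod (\<phi> y)"]) (auto simp: g_def)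
  qed
  define C where "C = 4 / (1 - \<rho>\<^sup>2) * M"
  define c where "c = (1 - \<rho>)\<^sup>2 * ((1 - (cmod z)\<^sup>2) / (1 + cmod z)\<^sup>2)"
  have hle: "h n t \<le> C" for n t
    unfolding h_def C_def M_def using glt[of "cis t" n] by (intro kernel_ratio_le nz \<rho>) auto
  have hge: "c \<le> h n t" for n t
    unfolding h_def c_def using glt[of "cis t" n] by (intro kernel_ratio_ge nz \<rho>) auto
  have "0 < c"
    unfolding c_def using \<rho> one_minus_norm_sq_pos[OF nz] norm_ge_zero[of z]
    by (intro mult_pos_pos divide_pos_pos zero_less_power) linarith+
  have hpos: "0 < h n t" for n t using hge[of n t] \<open>0 < c\<close> by linarith
  have conth: "continuous_on S (h n)" for S n
    unfolding h_def
    by (intro continuous_on_kernel_ratio nz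
        continuous_on_subset[OF holomorphic_on_imp_continuous_on[OF ghol]] sphere_cball)
  have lnh [measurable]: "(\<lambda>t. ln (h n t)) \<in> borel_measurable lebesgue" for n
    using hpos by (intro measurable_completion)
      (auto intro!: borel_measurable_continuous_onI continuous_on_ln conth simp: less_imp_neq[symmetric])
  have P [measurable]: "poisson z \<in> borel_measurable lebesgue"
    using nz by (intro measurable_completion) simp
  note A [measurable] = Emeas[folded A_def]
  have Asub: "A \<subseteq> {0..2*pi}" by (auto simp: A_def arcs_def)
  have \<omega>: "\<omega> = (LINT t:A|lebesgue. poisson z t) / (2 * pi)"
    by (simp add: \<omega>_def harmonic_measure_def A_def poisson_def)
  have intL: "integrable lebesgue (\<lambda>t. indicator A t * L t)"
    using logL1 by (simp add: set_integrable_def A_def L_def)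
  then have mL [measurable]: "(\<lambda>t. indicator A t * L t) \<in> borel_measurable lebesgue" by auto
  \<comment> \<open>The Poisson kernel is bounded by \<open>M\<close>, so integrability of
    \<open>L\<close> on \<open>A\<close> carries over to the product.\<close>
  have intLP: "set_integrable lebesgue A (\<lambda>t. L t * poisson z t)"
    unfolding set_integrable_def
  proof (rule Bochner_Integration.integrable_bound)
    show "integrable lebesgue (\<lambda>t. M * (indicator A t * L t))" using intL by simp
    have "(\<lambda>t. (indicator A t * L t) * poisson z t) \<in> borel_measurable lebesgue" by measurable
    then show "(\<lambda>t. indicator A t *\<^sub>R (L t * poisson z t)) \<in> borel_measurable lebesgue"
      by (simp add: mult.assoc)
    show "AE t in lebesgue. norm (indicator A t *\<^sub>R (L t * poisson z t)) \<le> norm (M * (indicator A t * L t))"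
    proof (rule AE_I2)
      fix t
      have "\<bar>indicator A t * L t\<bar> * poisson z t \<le> \<bar>indicator A t * L t\<bar> * M"
        unfolding M_def by (intro mult_left_mono poisson_le nz) auto
      then show "norm (indicator A t *\<^sub>R (L t * poisson z t)) \<le> norm (M * (indicator A t * L t))"
        using poisson_pos[OF nz, of t] poisson_le[OF nz, of t, folded M_def] by (simp add: abs_mult mult_ac)
    qed
  qed
  \<comment> \<open>Only an upper limit of \<open>ln (h n t)\<close> is known on \<open>A\<close>, so dominated convergence is applied to the excess over \<open>L\<close>.\<close>
  define s where "s = (\<lambda>n t. max (indicator A t * ln (h n t) - indicator A t * L t) 0 * poisson z t)"
  define B where "B = (\<lambda>t. (indicator A t * \<bar>ln C\<bar> + \<bar>indicator A t * L t\<bar>) * M)"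
  have intB: "integrable lebesgue B"
  proof -
    have "emeasure lebesgue A < \<infinity>"
      using emeasure_mono[OF Asub, of lebesgue] by (auto simp: less_top[symmetric] top_unique)
    then have "integrable lebesgue (indicator A :: real \<Rightarrow> real)"
      using A by simp
    then show ?thesis
      unfolding B_def using intL by (intro integrable_mult_left integrable_add integrable_abs) auto
  qed
  \<comment> \<open>A majorant independent of \<open>n\<close>: the logarithm is at most
    \<open>\<bar>ln C\<bar>\<close>, \<open>L\<close> enters with its absolute value, and the
    Poisson kernel is at most \<open>M\<close>.\<close>
  have sB: "norm (s n t) \<le> B t" for n t
  proof -
    have "ln (h n t) \<le> \<bar>ln C\<bar>"
      using hle[of n t] hpos[of n t] by (simp add: abs_le_iff order_trans[OF _ abs_ge_self])
    then have "indicator A t * ln (h n t) \<le> indicator A t * \<bar>ln C\<bar>"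
      by (intro mult_left_mono) auto
    moreover have "0 \<le> indicator A t * \<bar>ln C\<bar>" by simp
    ultimately have "max (indicator A t * ln (h n t) - indicator A t * L t) 0
        \<le> indicator A t * \<bar>ln C\<bar> + \<bar>indicator A t * L t\<bar>"
      by linarith
    from mult_mono[OF this poisson_le[OF nz, of t]] show ?thesis
      using poisson_pos[OF nz, of t] by (simp add: s_def B_def M_def abs_mult)
  qed
  have ms: "s n \<in> borel_measurable lebesgue" for n
    unfolding s_def by measurable
  have ints: "integrable lebesgue (s n)" for n
    by (rule Bochner_Integration.integrable_bound[OF intB ms])
      (auto intro!: AE_I2 order_trans[OF sB, unfolded real_norm_def] simp del: abs_le_iff)
  \<comment> \<open>At almost every point of \<open>A\<close> the upper limit of
    \<open>h n t\<close> is at most the modulus of the angular derivative, so the positive part of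
    the difference of logarithms tends to 0.\<close>
  have s0: "AE t in lebesgue. (\<lambda>n. s n t) \<longlonglongrightarrow> 0"
    using angE
  proof eventually_elim
    case (elim t)
    show ?case
    proof (cases "t \<in> A")
      case False
      then show ?thesis by (simp add: s_def)
    next
      case True
      define d where "d = cmod (angular_derivative \<phi> (cis t))"
      have ev: "\<forall>\<^sub>F n in sequentially. h n t < \<eta>" if "d < \<eta>" for \<eta>
      proof -
        have "\<forall>\<^sub>F r in at_left 1. kernel_ratio (\<lambda>u. \<phi> (of_real r * u)) z (cis t) < \<eta>"
          using elim True that
          by (intro eventually_kernel_ratio_less hol lt nz) (auto simp: A_def d_def)
        then show ?thesis
          unfolding h_def g_def using rlim by (rule eventually_compose_filterlim)
      qed
      \<comment> \<open>A vanishing derivative has to be excluded, because \<open>ln 0 = 0\<close>.\<close>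
      have "c \<le> \<eta>" if "d < \<eta>" for \<eta>
        using eventually_happens[OF ev[OF that]] hge[THEN order.strict_trans1] by (auto intro: less_imp_le)
      then have "c \<le> d" by (rule dense_ge)
      then have d: "0 < d" using \<open>0 < c\<close> by linarith
      have "(\<lambda>n. max (ln (h n t) - ln d) 0) \<longlonglongrightarrow> 0"
      proof (rule tendstoI)
        fix e :: real assume "0 < e"
        then have "d < d * exp e" using d by simp
        from ev[OF this] show "\<forall>\<^sub>F n in sequentially. dist (max (ln (h n t) - ln d) 0) 0 < e"
        proof eventually_elim
          case (elim n)
          have "ln (h n t) < ln (d * exp e)" using elim hpos[of n t] d by simp
          then have "ln (h n t) - ln d < e" using d by (simp add: ln_mult)
          then show ?case using \<open>0 < e\<close> by (simp add: dist_real_def)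
        qed
      qed
      from tendsto_mult_left_zero[OF this, of "poisson z t"] show ?thesis
        using True by (simp add: s_def L_def d_def)
    qed
  qed
  have "(\<lambda>n. integral\<^sup>L lebesgue (s n)) \<longlonglongrightarrow> integral\<^sup>L lebesgue (\<lambda>t::real. 0)"
  proof (rule integral_dominated_convergence[where w = B])
    show "AE t in lebesgue. norm (s n t) \<le> B t" for n by (intro AE_I2 sB)
  qed (use ms intB s0 in auto)
  then have slim: "(\<lambda>n. integral\<^sup>L lebesgue (s n)) \<longlonglongrightarrow> 0" by simp
  define J where "J = (LINT t:A|lebesgue. L t * poisson z t)"
  define K where "K = (1 - (cmod (\<phi> z))\<^sup>2) / (1 - (cmod z)\<^sup>2)"
  \<comment> \<open>On \<open>A\<close> the logarithm is at most \<open>L\<close> plus the excess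
    measured by \<open>s n\<close>, so replacing it by \<open>L\<close> costs an error that vanishes
    in the limit.\<close>
  have step: "ln ((1 - (cmod (g n z))\<^sup>2) / (1 - (cmod z)\<^sup>2)) \<le> (J + integral\<^sup>L lebesgue (s n)) / (2 * pi) + R" for n
  proof -
    have "set_integrable lebesgue {0..2*pi} (\<lambda>t. ln (h n t) * poisson z t)"
      using hpos nz by (intro absolutely_integrable_continuous_real continuous_intros conth)
        (auto simp: less_imp_neq[symmetric])
    then have int: "set_integrable lebesgue A (\<lambda>t. ln (h n t) * poisson z t)"
      using A Asub by (rule set_integrable_subset)
    have "(LINT t:A|lebesgue. ln (h n t) * poisson z t)
        \<le> (LINT t|lebesgue. indicator A t *\<^sub>R (L t * poisson z t) + s n t)"
      unfolding set_lebesgue_integral_def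
    proof (rule integral_mono)
      fix t
      have "ln (h n t) * poisson z t \<le> (L t + max (ln (h n t) - L t) 0) * poisson z t"
        using poisson_pos[OF nz, of t] by (intro mult_right_mono) auto
      then show "indicator A t *\<^sub>R (ln (h n t) * poisson z t) \<le> indicator A t *\<^sub>R (L t * poisson z t) + s n t"
        by (simp add: s_def indicator_def distrib_right)
    qed (use int intLP ints in \<open>auto simp: set_integrable_def\<close>)
    also have "\<dots> = J + integral\<^sup>L lebesgue (s n)"
      using intLP ints by (simp add: J_def set_lebesgue_integral_def set_integrable_def)
    finally have "(LINT t:A|lebesgue. ln (h n t) * poisson z t) / (2 * pi) \<le> (J + integral\<^sup>L lebesgue (s n)) / (2 * pi)"
      by (intro divide_right_mono) auto
    moreover have "ln ((1 - (cmod (g n z))\<^sup>2) / (1 - (cmod z)\<^sup>2))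
        \<le> (LINT t:A|lebesgue. ln (h n t) * poisson z t) / (2 * pi) + R"
      unfolding h_def R_def M_def by (intro ln_kernel_quotient_le_split ghol glt nz A Asub \<omega>)
    ultimately show ?thesis by linarith
  qed
  have Kpos: "0 < K"
    unfolding K_def by (intro divide_pos_pos one_minus_norm_sq_pos nz lt z)
  \<comment> \<open>Continuity at the interior point \<open>z\<close> handles the left side; the
    only boundary limit is the one already contained in \<open>slim\<close>.\<close>
  have "isCont \<phi> z"
    using hol z by (meson continuous_on_eq_continuous_at holomorphic_on_imp_continuous_on open_ball)
  moreover have "(\<lambda>n. of_real (r n) * z) \<longlonglongrightarrow> of_real 1 * z"
    using rlim by (intro tendsto_intros) (auto simp: filterlim_at)
  ultimately have "(\<lambda>n. g n z) \<longlonglongrightarrow> \<phi> z"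
    unfolding g_def by (auto intro: isCont_tendsto_compose)
  then have "(\<lambda>n. ln ((1 - (cmod (g n z))\<^sup>2) / (1 - (cmod z)\<^sup>2))) \<longlonglongrightarrow> ln K"
    using Kpos one_minus_norm_sq_pos[OF nz] unfolding K_def by (intro tendsto_intros) auto
  moreover have "(\<lambda>n. (J + integral\<^sup>L lebesgue (s n)) / (2 * pi) + R) \<longlonglongrightarrow> (J + 0) / (2 * pi) + R"
    by (intro tendsto_intros slim) auto
  ultimately have "ln K \<le> (J + 0) / (2 * pi) + R"
    using step by (auto intro: LIMSEQ_le)
  then have "exp (ln K) \<le> exp (J / (2 * pi)) * exp R"
    by (simp flip: exp_add)
  moreover have "exp R = (if \<omega> = 1 then 1 else (1 / (1 - \<omega>) * M) powr (1 - \<omega>))"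
  proof -
    have "0 < M" unfolding M_def using nz by (intro divide_pos_pos add_pos_nonneg) auto
    then show ?thesis by (auto simp: R_def powr_def)
  qed
  moreover have "exp (J / (2 * pi)) = cmod (outer_function
      (\<lambda>\<zeta>. if \<zeta> \<in> E then cmod (angular_derivative \<phi> \<zeta>) else 1) z)"
    using norm_outer_function[OF nz Emeas logL1] by (simp add: J_def A_def L_def)
  ultimately show ?thesis
    using Kpos by (simp only: exp_ln K_def \<omega>_def M_def)
qed

end
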